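(* Let $\mathscr{A}$ be a $C^*$-algebra and let $\mathscr{E}$ be a right Hilbert $\mathscr{A}$-module admitting at least one $*$-type conjugation, where in this statement a conjugation on $\mathscr{E}$ means a conjugate-linear map $C:\mathscr{E}\to\mathscr{E}$ such that $C^2=I_{\mathscr{E}}$ and $\langle Cx,y\rangle=\langle x,Cy\rangle^*$ for all $x,y\in\mathscr{E}$. Then the following statements are equivalent. (1) For all conjugations $C$ on $\mathscr{E}$, $C(xa)=C(x)a^*$ for all $x\in\mathscr{E}$, $a\in\mathscr{A}$. (2) For some conjugation $C$ on $\mathscr{E}$, $C(xa)=C(x)a^*$ for all $x\in\mathscr{E}$, $a\in\mathscr{A}$. (3) For every $x,y\in\mathscr{E}$ and $a\in\mathscr{A}$, $\langle xa,y\rangle=\langle x,ya^*\rangle$. (4) The closed ideal $\overline{\langle\mathscr{E},\mathscr{E}\rangle}$ is contained in the center $\mathcal{Z}(\mathscr{A})$ of $\mathscr{A}$.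
   Context: Inner products of right Hilbert $C^*$-modules are conjugate-linear in the first and linear in the second variable. $\langle\mathscr{E},\mathscr{E}\rangle$ denotes the linear span of $\{\langle x,y\rangle:x,y\in\mathscr{E}\}$; its closure is a closed two-sided ideal of $\mathscr{A}$. *)

theory Defs
  imports "HOL-Analysis.Analysis"
begin

class complex_vector = real_vector +
  fixes scaleC :: "complex \<Rightarrow> 'a \<Rightarrow> 'a" (infixr "*\<^sub>C" 75)
  assumes scaleC_add_right: "c *\<^sub>C (x + y) = c *\<^sub>C x + c *\<^sub>C y"
    and scaleC_add_left: "(c + d) *\<^sub>C x = c *\<^sub>C x + d *\<^sub>C x"
    and scaleC_scaleC: "c *\<^sub>C d *\<^sub>C x = (c * d) *\<^sub>C x"
    and scaleC_one: "1 *\<^sub>C x = x"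
    and scaleR_scaleC: "r *\<^sub>R x = complex_of_real r *\<^sub>C x"

interpretation complex_vector: vector_space "scaleC :: complex \<Rightarrow> 'a \<Rightarrow> 'a::complex_vector"
  by unfold_locales
    (simp_all add: scaleC_add_right scaleC_add_left scaleC_scaleC scaleC_one)

text \<open>No unit is required, and the algebra may be zero.\<close>

class cstar_algebra = complex_vector + real_normed_algebra + banach +
  fixes star :: "'a \<Rightarrow> 'a"
  assumes scaleC_mult_left: "(c *\<^sub>C a) * b = c *\<^sub>C (a * b)"
    and scaleC_mult_right: "a * (c *\<^sub>C b) = c *\<^sub>C (a * b)"
    and norm_scaleC: "norm (c *\<^sub>C a) = cmod c * norm a"
    and star_star: "star (star a) = a"
    and star_add: "star (a + b) = star a + star b"
    and star_scaleC: "star (c *\<^sub>C a) = cnj c *\<^sub>C star a"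
    and star_mult: "star (a * b) = star b * star a"
    and cstar_identity: "norm (star a * a) = (norm a)\<^sup>2"

definition positive :: "'a::cstar_algebra \<Rightarrow> bool" where
  "positive a \<longleftrightarrow> (\<exists>b. a = star b * b)"

definition center :: "'a::cstar_algebra set" where
  "center = {z. \<forall>a. z * a = a * z}"

text \<open>
  A right Hilbert module with action \<open>act x a\<close> (written $xa$) and inner product
  \<open>ip x y\<close>.  By \<open>norm_eq\<close> the norm of the type is the one induced by the inner
  product, so its class \<^class>\<open>banach\<close> expresses completeness of the module.
\<close>

locale hilbert_module =
  fixes act :: "'e::{complex_vector, banach} \<Rightarrow> 'a::cstar_algebra \<Rightarrow> 'e"
    and ip :: "'e \<Rightarrow> 'e \<Rightarrow> 'a"
  assumes act_add_left: "act (x + y) a = act x a + act y a"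
    and act_add_right: "act x (a + b) = act x a + act x b"
    and act_mult: "act x (a * b) = act (act x a) b"
    and act_scaleC_left: "act (c *\<^sub>C x) a = c *\<^sub>C act x a"
    and act_scaleC_right: "act x (c *\<^sub>C a) = c *\<^sub>C act x a"
    and ip_add_right: "ip x (y + z) = ip x y + ip x z"
    and ip_scaleC_right: "ip x (c *\<^sub>C y) = c *\<^sub>C ip x y"
    and ip_act_right: "ip x (act y a) = ip x y * a"
    and ip_star: "star (ip x y) = ip y x"
    and ip_positive: "positive (ip x x)"
    and ip_definite: "ip x x = 0 \<Longrightarrow> x = 0"
    and norm_eq: "norm x = sqrt (norm (ip x x))"

definition conjugate_linear :: "('e::complex_vector \<Rightarrow> 'f::complex_vector) \<Rightarrow> bool" where
  "conjugate_linear C \<longleftrightarrow>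
    (\<forall>x y. C (x + y) = C x + C y) \<and> (\<forall>c x. C (c *\<^sub>C x) = cnj c *\<^sub>C C x)"

definition conjugation ::
    "('e::complex_vector \<Rightarrow> 'e \<Rightarrow> 'a::cstar_algebra) \<Rightarrow> ('e \<Rightarrow> 'e) \<Rightarrow> bool" where
  "conjugation ip C \<longleftrightarrow>
    conjugate_linear C \<and> C \<circ> C = id \<and> (\<forall>x y. ip (C x) y = star (ip x (C y)))"

definition ip_span :: "('e \<Rightarrow> 'e \<Rightarrow> 'a::cstar_algebra) \<Rightarrow> 'a set" where
  "ip_span ip = complex_vector.span {ip x y | x y. True}"

end

theory Submission
  imports Defs
begin

text \<open>
  Taking adjoints in \<open>\<langle>y,xa\<rangle> = \<langle>y,x\<rangle>a\<close> gives \<open>\<langle>xa,y\<rangle> = a\<^sup>*\<langle>x,y\<rangle>\<close>, so (3) says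
  that all inner products are central, and (4) says the same because the center is a closed
  subspace.  Any conjugation satisfies \<open>\<langle>C(xa),y\<rangle> = \<langle>Cx,y\<rangle>a\<close>, while
  \<open>\<langle>C(x)a\<^sup>*,y\<rangle> = a\<langle>Cx,y\<rangle>\<close>; by nondegeneracy and surjectivity of \<open>C\<close>, a conjugation
  fulfils \<open>C(xa) = C(x)a\<^sup>*\<close> exactly when all inner products are central.
\<close>

lemma closed_center: "closed (center :: 'a::cstar_algebra set)"
proof -
  have "center = (\<Inter>a. {z::'a. z * a = a * z})"
    by (auto simp: center_def)
  moreover have "closed (\<Inter>a. {z::'a. z * a = a * z})"
    by (intro closed_INT ballI closed_Collect_eq continuous_intros)
  ultimately show ?thesis
    by simp
qed

lemma subspace_center: "complex_vector.subspace (center :: 'a::cstar_algebra set)"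
  by (auto simp: complex_vector.subspace_def center_def distrib_left distrib_right
      scaleC_mult_left scaleC_mult_right)

lemma closure_ip_span_subset_center_iff:
  "closure (ip_span ip) \<subseteq> center \<longleftrightarrow> (\<forall>x y. ip x y \<in> center)"
proof
  assume "closure (ip_span ip) \<subseteq> center"
  moreover have "ip x y \<in> closure (ip_span ip)" for x y
    unfolding ip_span_def
    by (intro closure_subset[THEN subsetD] complex_vector.span_base) auto
  ultimately show "\<forall>x y. ip x y \<in> center"
    by blast
next
  assume "\<forall>x y. ip x y \<in> center"
  then have "ip_span ip \<subseteq> center"
    unfolding ip_span_def
    by (intro complex_vector.span_minimal subspace_center) auto
  then show "closure (ip_span ip) \<subseteq> center"
    by (intro closure_minimal closed_center)
qed

context hilbert_module
begin

lemma ip_act_left: "ip (act x a) y = star a * ip x y"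
  by (metis ip_act_right ip_star star_mult)

lemma ip_add_left: "ip (x + y) z = ip x z + ip y z"
  by (metis ip_add_right ip_star star_add)

lemma ip_left_cancel:
  assumes "\<And>z. ip x z = ip y z"
  shows "x = y"
proof -
  \<comment> \<open>Additivity is applied to \<open>x = (x - y) + y\<close>; definiteness then uses
    the instance \<open>z = x - y\<close>.\<close>
  have "ip (x - y) z = 0" for z
    using ip_add_left[of "x - y" y z] assms by simp
  then show ?thesis
    using ip_definite[of "x - y"] by simp
qed

text \<open>The two sides are \<open>star a * ip x y\<close> and \<open>ip x y * star a\<close>, and
  \<open>star a\<close> runs through the whole algebra because \<open>star\<close> is an
  involution.\<close>

lemma ip_act_adjoint_iff_center:
  "(\<forall>x y a. ip (act x a) y = ip x (act y (star a))) \<longleftrightarrow> (\<forall>x y. ip x y \<in> center)"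
  unfolding ip_act_left ip_act_right center_def mem_Collect_eq
  by (metis star_star)

text \<open>Moving \<open>C\<close> to the second slot gives
  \<open>star (star a * ip x (C y))\<close>: the adjoints on \<open>a\<close> cancel and the outer
  one reverses the product, so \<open>a\<close> ends up unstarred on the right.\<close>

lemma ip_conjugation_act:
  assumes "conjugation ip C"
  shows "ip (C (act x a)) y = ip (C x) y * a"
proof -
  have "ip (C u) v = star (ip u (C v))" for u v
    using assms by (simp add: conjugation_def)
  then show ?thesis
    by (simp add: ip_act_left star_mult star_star)
qed

lemma conjugation_act_iff_center:
  assumes C: "conjugation ip C"
  shows "(\<forall>x a. C (act x a) = act (C x) (star a)) \<longleftrightarrow> (\<forall>x y. ip x y \<in> center)"
proof
  assume eq: "\<forall>x a. C (act x a) = act (C x) (star a)"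
  \<comment> \<open>Makes \<open>C\<close> surjective, so commutation of all
    \<open>ip (C x) y\<close> covers every inner product.\<close>
  have "C (C x) = x" for x
    using C by (metis comp_apply conjugation_def id_apply)
  moreover have "ip (C x) y * a = a * ip (C x) y" for x y a
    using ip_conjugation_act[OF C, of x a y] eq by (simp add: ip_act_left star_star)
  ultimately show "\<forall>x y. ip x y \<in> center"
    unfolding center_def mem_Collect_eq by metis
next
  assume "\<forall>x y. ip x y \<in> center"
  then have "ip (C (act x a)) y = ip (act (C x) (star a)) y" for x a y
    by (simp add: ip_conjugation_act[OF C] ip_act_left star_star center_def)
  then show "\<forall>x a. C (act x a) = act (C x) (star a)"
    by (blast intro: ip_left_cancel)
qed

end

theorem theorem6p1:
  fixes act :: "'e::{complex_vector, banach} \<Rightarrow> 'a::cstar_algebra \<Rightarrow> 'e"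
    and ip :: "'e \<Rightarrow> 'e \<Rightarrow> 'a"
  assumes "hilbert_module act ip"
    and "\<exists>C. conjugation ip C"
  defines "S1 \<equiv> \<forall>C. conjugation ip C \<longrightarrow> (\<forall>x a. C (act x a) = act (C x) (star a))"
    and "S2 \<equiv> \<exists>C. conjugation ip C \<and> (\<forall>x a. C (act x a) = act (C x) (star a))"
    and "S3 \<equiv> \<forall>x y a. ip (act x a) y = ip x (act y (star a))"
    and "S4 \<equiv> closure (ip_span ip) \<subseteq> center"
  shows "(S1 \<longleftrightarrow> S2) \<and> (S2 \<longleftrightarrow> S3) \<and> (S3 \<longleftrightarrow> S4)"
proof -
  interpret hilbert_module act ip
    by fact
  let ?Z = "\<forall>x y. ip x y \<in> center"
  \<comment> \<open>Since \<open>?Z\<close> does not mention \<open>C\<close>, one conjugation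
    satisfies the action law iff all do; the assumed existence of a conjugation keeps
    \<open>S1\<close> from being vacuous.\<close>
  have "S1 \<longleftrightarrow> ?Z" and "S2 \<longleftrightarrow> ?Z"
    using assms(2) conjugation_act_iff_center unfolding S1_def S2_def by blast+
  moreover have "S3 \<longleftrightarrow> ?Z"
    unfolding S3_def by (rule ip_act_adjoint_iff_center)
  moreover have "S4 \<longleftrightarrow> ?Z"
    unfolding S4_def by (rule closure_ip_span_subset_center_iff)
  ultimately show ?thesis
    by simp
qed

end
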